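(* Let $n\geq 2$ be an integer and let $B$ be a non-empty subset of $U(n)$. Then $C_{\mathbb Z_n',B}(n)=4$ and $D_{\mathbb Z_n',B}(n)=3$.
   Context: $\mathbb Z_n=\mathbb Z/n\mathbb Z$ as a module over itself, $\mathbb Z_n'=\mathbb Z_n\setminus\{0\}$, $U(n)$ the group of units of $\mathbb Z_n$. A subsequence is a non-empty subfamily of terms in the original order. A sequence $(x_1,\ldots,x_k)$ is an $(A,B)$-weighted zero-sum sequence if there exist $a_i\in A$, $b_i\in B$ with $\sum a_ix_i=0$ and $\sum b_ia_i=0$. $C_{A,B}(n)$ is the least positive $k$ such that every sequence of length $k$ in $\mathbb Z_n$ has an $(A,B)$-weighted zero-sum subsequence having consecutive terms (a non-empty block $(x_i,\ldots,x_j)$); $D_{A,B}(n)$ is the least positive $k$ such that every sequence of length $k$ in $\mathbb Z_n$ has an $(A,B)$-weighted zero-sum subsequence. *)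

theory Defs
  imports "HOL-Number_Theory.Residues" "HOL-Library.Sublist" "HOL-Library.Extended_Nat"
begin

text \<open>
  The ring \<open>R\<close> is also the module over itself in which the terms of the sequences lie. The choice
  of weights from \<open>B\<close> may vary with the index.
\<close>

definition weighted_zero_sum ::
    "('a, 'b) ring_scheme \<Rightarrow> 'a set \<Rightarrow> 'a set \<Rightarrow> 'a list \<Rightarrow> bool" where
  "weighted_zero_sum R A B xs \<longleftrightarrow>
     (\<exists>as bs. length as = length xs \<and> length bs = length xs \<and> set as \<subseteq> A \<and> set bs \<subseteq> B \<and>
       (\<Oplus>\<^bsub>R\<^esub>i\<in>{..<length xs}. as ! i \<otimes>\<^bsub>R\<^esub> xs ! i) = \<zero>\<^bsub>R\<^esub> \<and>
       (\<Oplus>\<^bsub>R\<^esub>i\<in>{..<length xs}. bs ! i \<otimes>\<^bsub>R\<^esub> as ! i) = \<zero>\<^bsub>R\<^esub>)"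

text \<open>
  Least positive lengths, taken in \<^typ>\<open>enat\<close> so that the value is \<open>\<infinity>\<close>
  (rather than an unspecified number) when no length has the required property. The empty list
  is a \<^const>\<open>sublist\<close> and a \<^const>\<open>subseq\<close> of every list and has to be excluded.
\<close>

definition C_const :: "int \<Rightarrow> int set \<Rightarrow> int set \<Rightarrow> enat" where
  "C_const n A B = Inf {enat k | k. k > 0 \<and>
     (\<forall>xs. set xs \<subseteq> carrier (residue_ring n) \<and> length xs = k \<longrightarrow>
       (\<exists>ys. ys \<noteq> [] \<and> sublist ys xs \<and> weighted_zero_sum (residue_ring n) A B ys))}"

definition D_const :: "int \<Rightarrow> int set \<Rightarrow> int set \<Rightarrow> enat" where
  "D_const n A B = Inf {enat k | k. k > 0 \<and>
     (\<forall>xs. set xs \<subseteq> carrier (residue_ring n) \<and> length xs = k \<longrightarrow>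
       (\<exists>ys. ys \<noteq> [] \<and> subseq ys xs \<and> weighted_zero_sum (residue_ring n) A B ys))}"

end

theory Submission
  imports Defs
begin

text \<open>
  A single term is never a weighted zero-sum sequence, since the weights in \<open>B\<close> are units. If
  exactly one term of a sequence is 1 and the others are 0, the weight of that term would have to
  be 0. So \<open>(0, 1)\<close> and \<open>(0, 1, 0)\<close> give the lower bounds.

  For the upper bounds take the same \<open>b \<in> B\<close> throughout, so that the second condition becomes
  \<open>\<Sum> a\<^sub>i = 0\<close>. Equal terms \<open>(x, x)\<close> have the weights \<open>(1, -1)\<close>, distinct terms \<open>(x, y, z)\<close> have
  the weights \<open>(y - z, z - x, x - y)\<close>, and a sequence of length 4 without a consecutive block of
  either kind is of the form \<open>(x, y, x, y)\<close>, with weights \<open>(1, 1, -1, -1)\<close>.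
\<close>

lemma (in residues) finsum_mult_eq:
  assumes "finite I"
  shows "(\<Oplus>i\<in>I. f i \<otimes> g i) = (\<Sum>i\<in>I. f i * g i) mod m"
  using assms
proof (induction I)
  case empty
  then show ?case by (simp add: zero_cong)
next
  case (insert i I)
  \<comment> \<open>The product is reduced modulo \<open>m\<close>, so it lies in the carrier for
    arbitrary integers \<open>f i\<close> and \<open>g i\<close>.\<close>
  have "(\<lambda>i. f i \<otimes> g i) \<in> J \<rightarrow> carrier R" for J
    using m_gt_one by (auto simp: res_mult_eq res_carrier_eq)
  then show ?case
    using insert by (simp add: finsum_insert Pi_iff res_mult_eq res_add_eq mod_add_eq)
qed

lemma (in residues) weighted_zero_sum_iff:
  "weighted_zero_sum R A B xs \<longleftrightarrow>
     (\<exists>as bs. length as = length xs \<and> length bs = length xs \<and> set as \<subseteq> A \<and> set bs \<subseteq> B \<and>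
       m dvd (\<Sum>i<length xs. as ! i * xs ! i) \<and> m dvd (\<Sum>i<length xs. bs ! i * as ! i))"
  unfolding weighted_zero_sum_def
  by (simp add: finsum_mult_eq res_zero_eq dvd_eq_mod_eq_0)

text \<open>Reduction modulo \<open>m\<close> turns integers not divisible by \<open>m\<close> into
  non-zero residues, so weights such as \<open>-1\<close> or \<open>y - z\<close> can be given
  unreduced. With a constant \<open>b\<close> as the weight from \<open>B\<close>, the second sum is
  congruent to \<open>b\<close> times the sum of \<open>as\<close>.\<close>

lemma (in residues) weighted_zero_sumI:
  assumes "B \<noteq> {}" "length as = length xs"
    and nz: "\<And>a. a \<in> set as \<Longrightarrow> \<not> m dvd a"
    and dvd: "m dvd (\<Sum>i<length xs. as ! i * xs ! i)" "m dvd (\<Sum>i<length xs. as ! i)"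
  shows "weighted_zero_sum R (carrier R - {\<zero>}) B xs"
proof -
  obtain b where "b \<in> B" using assms(1) by auto
  let ?as = "map (\<lambda>a. a mod m) as" and ?bs = "replicate (length xs) b"
  have "[(\<Sum>i<length xs. ?as ! i * xs ! i) = (\<Sum>i<length xs. as ! i * xs ! i)] (mod m)"
    by (rule cong_sum) (simp add: assms(2) cong_def mod_mult_left_eq)
  moreover have "[(\<Sum>i<length xs. ?bs ! i * ?as ! i) = b * (\<Sum>i<length xs. as ! i)] (mod m)"
    unfolding sum_distrib_left
    by (rule cong_sum) (simp add: assms(2) cong_def mod_mult_right_eq)
  moreover have "set ?as \<subseteq> carrier R - {\<zero>}"
    using nz m_gt_one by (auto simp: res_carrier_eq res_zero_eq dvd_eq_mod_eq_0)
  moreover have "set ?bs \<subseteq> B"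
    using \<open>b \<in> B\<close> by auto
  ultimately show ?thesis
    unfolding weighted_zero_sum_iff using dvd assms(2)
    by (intro exI[of _ ?as] exI[of _ ?bs]) (simp add: cong_dvd_iff del: set_map set_replicate_conv_if)
qed

lemma (in residues) eq_iff_dvd_diff:
  assumes "x \<in> carrier R" "y \<in> carrier R"
  shows "m dvd x - y \<longleftrightarrow> x = y"
  using assms by (auto simp: res_carrier_eq mod_eq_dvd_iff[symmetric])

lemma (in residues) weighted_zero_sum_equal_pair:
  assumes "B \<noteq> {}"
  shows "weighted_zero_sum R (carrier R - {\<zero>}) B [x, x]"
  by (rule weighted_zero_sumI[where as = "[1, -1]"])
    (use assms m_gt_one in \<open>auto simp: zdvd_not_zless\<close>)

lemma (in residues) weighted_zero_sum_distinct_triple: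
  assumes "B \<noteq> {}" "{x, y, z} \<subseteq> carrier R" "x \<noteq> y" "y \<noteq> z" "x \<noteq> z"
  shows "weighted_zero_sum R (carrier R - {\<zero>}) B [x, y, z]"
\<comment> \<open>The weights form the cross product of \<open>(1, 1, 1)\<close> and
  \<open>(x, y, z)\<close> up to sign, so both sums vanish already over the integers; distinctness
  makes all three weights non-zero modulo \<open>m\<close>.\<close>
proof (rule weighted_zero_sumI[where as = "[y - z, z - x, x - y]"])
  have "\<not> m dvd y - z" "\<not> m dvd z - x" "\<not> m dvd x - y"
    using assms by (simp_all add: eq_iff_dvd_diff)
  then show "\<not> m dvd a" if "a \<in> set [y - z, z - x, x - y]" for a
    using that by auto
qed (use assms(1) in \<open>simp_all add: lessThan_Suc algebra_simps\<close>)

lemma (in residues) weighted_zero_sum_alternating: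
  assumes "B \<noteq> {}"
  shows "weighted_zero_sum R (carrier R - {\<zero>}) B [x, y, x, y]"
  by (rule weighted_zero_sumI[where as = "[1, 1, -1, -1]"])
    (use assms m_gt_one in \<open>auto simp: zdvd_not_zless lessThan_Suc\<close>)

lemma (in residues) not_weighted_zero_sum_singleton:
  assumes "B \<subseteq> Units R"
  shows "\<not> weighted_zero_sum R (carrier R - {\<zero>}) B [x]"
proof
  assume "weighted_zero_sum R (carrier R - {\<zero>}) B [x]"
  then obtain a b where "a \<in> carrier R - {\<zero>}" "b \<in> B" "m dvd b * a"
    unfolding weighted_zero_sum_iff by (auto simp: length_Suc_conv)
  \<comment> \<open>A unit \<open>b\<close> can be cancelled from \<open>m dvd b * a\<close>, but
    \<open>0 < a < m\<close> rules out \<open>m dvd a\<close>.\<close>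
  moreover from this have "coprime m b"
    using assms by (auto simp: res_units_eq coprime_commute)
  ultimately show False
    by (auto simp: coprime_dvd_mult_right_iff res_carrier_eq res_zero_eq dest: zdvd_imp_le)
qed

text \<open>The first sum collapses to the weight of the entry 1, so the choice of \<open>B\<close>
  does not matter. The lists are the blocks of \<open>[0, 1, 0]\<close> with at least two terms. The
  equal pair \<open>[0, 0]\<close> is a subsequence of it but not a block, which is where
  \<open>C_const\<close> and \<open>D_const\<close> part.\<close>

lemma (in residues) not_weighted_zero_sum_one_zeros:
  assumes "ys \<in> {[0, 1], [1, 0], [0, 1, 0]}"
  shows "\<not> weighted_zero_sum R (carrier R - {\<zero>}) B ys"
proof
  assume "weighted_zero_sum R (carrier R - {\<zero>}) B ys"
  then obtain a where "a \<in> carrier R - {\<zero>}" "m dvd a"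
    using assms unfolding weighted_zero_sum_iff
    by (auto simp: length_Suc_conv lessThan_Suc)
  then show False
    by (auto simp: res_carrier_eq res_zero_eq dest: zdvd_imp_le)
qed

lemma (in residues) C_const_eq:
  assumes B: "B \<noteq> {}" "B \<subseteq> Units R"
  shows "C_const m (carrier R - {\<zero>}) B = 4"
proof -
  let ?P = "weighted_zero_sum R (carrier R - {\<zero>}) B"
  have upper: "\<exists>ys. ys \<noteq> [] \<and> sublist ys xs \<and> ?P ys"
    if xs_carrier: "set xs \<subseteq> carrier R" and len: "length xs = 4" for xs
  proof -
    obtain x y z w where xs: "xs = [x, y, z, w]"
      using len by (auto simp: eval_nat_numeral length_Suc_conv)
    \<comment> \<open>If all neighbours differ, then \<open>x \<noteq> z\<close> makes the first
      three terms distinct and \<open>y \<noteq> w\<close> the last three; otherwise the sequence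
      alternates.\<close>
    consider "x = y" | "y = z" | "z = w" | "x \<noteq> y" "y \<noteq> z" "x \<noteq> z"
      | "y \<noteq> z" "z \<noteq> w" "y \<noteq> w" | "x = z" "y = w" by blast
    then show ?thesis
    proof cases
      case 1
      then show ?thesis using weighted_zero_sum_equal_pair[OF B(1), of x]
        by (intro exI[of _ "[x, x]"]) (simp add: xs)
    next
      case 2
      then show ?thesis using weighted_zero_sum_equal_pair[OF B(1), of y]
        by (intro exI[of _ "[y, y]"]) (simp add: xs sublist_Cons_right)
    next
      case 3
      then show ?thesis using weighted_zero_sum_equal_pair[OF B(1), of z]
        by (intro exI[of _ "[z, z]"]) (simp add: xs sublist_Cons_right)
    next
      case 4
      then show ?thesis using weighted_zero_sum_distinct_triple[OF B(1), of x y z] xs_carrier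
        by (intro exI[of _ "[x, y, z]"]) (simp add: xs)
    next
      case 5
      then show ?thesis using weighted_zero_sum_distinct_triple[OF B(1), of y z w] xs_carrier
        by (intro exI[of _ "[y, z, w]"]) (simp add: xs sublist_Cons_right)
    next
      case 6
      then show ?thesis using weighted_zero_sum_alternating[OF B(1), of x y]
        by (intro exI[of _ xs]) (simp add: xs)
    qed
  qed
  have lower: "4 \<le> k"
    if "k > 0" and *: "\<And>xs. set xs \<subseteq> carrier R \<Longrightarrow> length xs = k \<Longrightarrow>
      \<exists>ys. ys \<noteq> [] \<and> sublist ys xs \<and> ?P ys" for k :: nat
  proof (rule ccontr)
    assume "\<not> 4 \<le> k"
    \<comment> \<open>The infimum ranges over all good lengths, so each \<open>k < 4\<close> needs
      its own counterexample; the prefixes of \<open>[0, 1, 0]\<close> provide them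
      uniformly.\<close>
    then have len: "length (take k [0, 1, 0 :: int]) = k" by simp
    have "set (take k [0, 1, 0]) \<subseteq> carrier R"
      using m_gt_one set_take_subset[of k "[0, 1, 0]"] by (auto simp: res_carrier_eq)
    with *[OF _ len] obtain ys where "ys \<noteq> []" "sublist ys (take k [0, 1, 0])" "?P ys"
      by blast
    \<comment> \<open>A block of a prefix is a block of the whole list, which leaves only singletons
      and the three lists excluded above.\<close>
    moreover from this have "ys \<in> set (sublists [0, 1, 0])"
      unfolding set_sublists_eq
      using sublist_order.order_trans sublist_take by blast
    ultimately show False
      using not_weighted_zero_sum_singleton[OF B(2)] not_weighted_zero_sum_one_zeros by auto
  qed
  show ?thesis
    unfolding C_const_def R_m_def[symmetric]
  proof (rule antisym)
    show "Inf {enat k |k. 0 < k \<and> (\<forall>xs. set xs \<subseteq> carrier R \<and> length xs = k \<longrightarrow>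
        (\<exists>ys. ys \<noteq> [] \<and> sublist ys xs \<and> ?P ys))} \<le> 4"
      using upper by (intro Inf_lower) (auto intro!: exI[of _ 4] simp: numeral_eq_enat)
  qed (auto intro!: Inf_greatest lower simp: numeral_eq_enat)
qed

lemma (in residues) D_const_eq:
  assumes B: "B \<noteq> {}" "B \<subseteq> Units R"
  shows "D_const m (carrier R - {\<zero>}) B = 3"
proof -
  let ?P = "weighted_zero_sum R (carrier R - {\<zero>}) B"
  have upper: "\<exists>ys. ys \<noteq> [] \<and> subseq ys xs \<and> ?P ys"
    if xs_carrier: "set xs \<subseteq> carrier R" and len: "length xs = 3" for xs
  proof -
    obtain x y z where xs: "xs = [x, y, z]"
      using len by (auto simp: eval_nat_numeral length_Suc_conv)
    show ?thesis
    proof (cases "distinct xs")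
      case True
      then show ?thesis using weighted_zero_sum_distinct_triple[OF B(1), of x y z] xs_carrier
        by (intro exI[of _ xs]) (auto simp: xs)
    next
      case False
      \<comment> \<open>A repeated value among three terms first occurs at \<open>x\<close> or
        \<open>y\<close>.\<close>
      then have "\<exists>u\<in>{x, y}. subseq [u, u] xs" by (auto simp: xs)
      then obtain u where "subseq [u, u] xs" by blast
      then show ?thesis using weighted_zero_sum_equal_pair[OF B(1), of u]
        by (intro exI[of _ "[u, u]"]) simp
    qed
  qed
  have lower: "3 \<le> k"
    if "k > 0" and *: "\<And>xs. set xs \<subseteq> carrier R \<Longrightarrow> length xs = k \<Longrightarrow>
      \<exists>ys. ys \<noteq> [] \<and> subseq ys xs \<and> ?P ys" for k :: nat
  proof (rule ccontr)
    assume "\<not> 3 \<le> k"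
    then have len: "length (take k [0, 1 :: int]) = k" by simp
    have "set (take k [0, 1]) \<subseteq> carrier R"
      using m_gt_one set_take_subset[of k "[0, 1]"] by (auto simp: res_carrier_eq)
    with *[OF _ len] obtain ys where "ys \<noteq> []" "subseq ys (take k [0, 1])" "?P ys"
      by blast
    \<comment> \<open>The non-empty subsequences of \<open>[0, 1]\<close> are the two singletons and
      the list itself.\<close>
    moreover from this have "ys \<in> set (subseqs [0, 1])"
      unfolding set_subseqs_eq
      using subseq_order.order_trans prefix_imp_subseq take_is_prefix by blast
    ultimately show False
      using not_weighted_zero_sum_singleton[OF B(2)] not_weighted_zero_sum_one_zeros
      by (auto simp: Let_def)
  qed
  show ?thesis
    unfolding D_const_def R_m_def[symmetric]
  proof (rule antisym)
    show "Inf {enat k |k. 0 < k \<and> (\<forall>xs. set xs \<subseteq> carrier R \<and> length xs = k \<longrightarrow>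
        (\<exists>ys. ys \<noteq> [] \<and> subseq ys xs \<and> ?P ys))} \<le> 3"
      using upper by (intro Inf_lower) (auto intro!: exI[of _ 3] simp: numeral_eq_enat)
  qed (auto intro!: Inf_greatest lower simp: numeral_eq_enat)
qed

theorem theorem24:
  fixes n :: int and B :: "int set"
  assumes "n \<ge> 2"
    and "B \<noteq> {}" and "B \<subseteq> Units (residue_ring n)"
  shows "C_const n (carrier (residue_ring n) - {\<zero>\<^bsub>residue_ring n\<^esub>}) B = 4 \<and>
         D_const n (carrier (residue_ring n) - {\<zero>\<^bsub>residue_ring n\<^esub>}) B = 3"
proof -
  interpret residues n "residue_ring n"
    using assms(1) by unfold_locales auto
  show ?thesis using C_const_eq D_const_eq assms(2,3) by blast
qed

end
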